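(* There exists a constant $K>0$ such that for all integers $n\ge 2$ and all $y \in \{1,\dots,n-1\}$, $$f(n,y) \leq K\frac{y}{n},$$ where $f:\bar{\mathcal{R}}(n)\to\mathbb{R}$ is the unique bounded solution of the discrete Dirichlet problem in $\mathcal{R}(n)$ with boundary value $1$ on $\{(0,y'):1\le y'\le n-1\}$ and $0$ on the rest of the boundary, i.e. $f$ is bounded, $\Delta f=0$ in $\mathcal{R}(n)$, $f=1$ on $\{(0,y'):1\le y'\le n-1\}$, and $f=0$ on $\partial\mathcal{R}(n)\setminus\{(0,y'):1\le y'\le n-1\}$.
   Context: $\mathcal{R}(n)=\{(x,y) \in \mathbb{Z}^2:x \geq 1,\ 1 \leq y \leq n-1\}$. The boundary of a set $D\subset\mathbb{Z}^2$ is $\partial D=\{w\in\mathbb{Z}^2: w\notin D,\ \exists z\in D \text{ with } |z-w|=1\}$ ($|\cdot|$ the Euclidean norm), and $\bar{\mathcal{R}}(n)=\mathcal{R}(n)\cup\partial\mathcal{R}(n)$. The discrete Laplacian is $\Delta f(x,y)=\frac14\sum (f(x',y')-f(x,y))$, the sum being over the four $(x',y')\in\mathbb{Z}^2$ with $|(x',y')-(x,y)|=1$. *)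

theory Defs
  imports "HOL-Analysis.Analysis"
begin

text \<open>The Euclidean distance on the integer lattice, via the inclusion into the plane.\<close>

definition lattice_dist :: "int \<times> int \<Rightarrow> int \<times> int \<Rightarrow> real" where
  "lattice_dist z w =
     dist (real_of_int (fst z), real_of_int (snd z)) (real_of_int (fst w), real_of_int (snd w))"

definition neighbours :: "int \<times> int \<Rightarrow> (int \<times> int) set" where
  "neighbours z = {w. lattice_dist w z = 1}"

lemma neighbours_eq:
  "neighbours (x, y) = {(x + 1, y), (x - 1, y), (x, y + 1), (x, y - 1)}"
proof -
  have unit: "a\<^sup>2 + b\<^sup>2 = 1 \<longleftrightarrow> (a, b) \<in> {(1, 0), (-1, 0), (0, 1), (0, -1)}" for a b :: int
  proof
    assume h: "a\<^sup>2 + b\<^sup>2 = 1"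
    have "a\<^sup>2 \<le> 1\<^sup>2" "b\<^sup>2 \<le> 1\<^sup>2"
      using h zero_le_power2[of a] zero_le_power2[of b] by (simp_all, linarith+)
    then have "\<bar>a\<bar> \<le> 1" "\<bar>b\<bar> \<le> 1"
      using abs_le_square_iff[of a 1] abs_le_square_iff[of b 1] by simp_all
    then have "a \<in> {-1, 0, 1}" "b \<in> {-1, 0, 1}" by auto
    then show "(a, b) \<in> {(1, 0), (-1, 0), (0, 1), (0, -1)}" using h by auto
  qed auto
  have "lattice_dist (u, v) (x, y) = 1 \<longleftrightarrow> (u - x)\<^sup>2 + (v - y)\<^sup>2 = 1" for u v
  proof -
    have "lattice_dist (u, v) (x, y) = sqrt (real_of_int ((u - x)\<^sup>2 + (v - y)\<^sup>2))"
      by (simp add: lattice_dist_def dist_Pair_Pair dist_real_def)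
    then show ?thesis by (simp only: real_sqrt_eq_1_iff of_int_eq_1_iff)
  qed
  then have "(u, v) \<in> neighbours (x, y) \<longleftrightarrow>
      (u - x, v - y) \<in> {(1, 0), (-1, 0), (0, 1), (0, -1)}" for u v
    unfolding neighbours_def using unit[of "u - x" "v - y"] by simp
  then show ?thesis by (auto simp: set_eq_iff)
qed

definition lattice_boundary :: "(int \<times> int) set \<Rightarrow> (int \<times> int) set" where
  "lattice_boundary D = {w. w \<notin> D \<and> (\<exists>z\<in>D. lattice_dist z w = 1)}"

definition lattice_closure :: "(int \<times> int) set \<Rightarrow> (int \<times> int) set" where
  "lattice_closure D = D \<union> lattice_boundary D"

definition discrete_laplacian :: "(int \<times> int \<Rightarrow> real) \<Rightarrow> int \<times> int \<Rightarrow> real" where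
  "discrete_laplacian f z = 1/4 * (\<Sum>w\<in>neighbours z. f w - f z)"

definition half_strip :: "int \<Rightarrow> (int \<times> int) set" where
  "half_strip n = {(x, y). x \<ge> 1 \<and> 1 \<le> y \<and> y \<le> n - 1}"

definition left_side :: "int \<Rightarrow> (int \<times> int) set" where
  "left_side n = {(x, y). x = 0 \<and> 1 \<le> y \<and> y \<le> n - 1}"

text \<open>A function defined only on the closure of the half-strip is represented by a total
  function that is \<^const>\<open>extensional\<close> there (equal to \<^const>\<open>undefined\<close> elsewhere),
  so that uniqueness on the closure is uniqueness as a HOL function.\<close>

definition bounded_dirichlet_solution :: "int \<Rightarrow> (int \<times> int \<Rightarrow> real) \<Rightarrow> bool" where
  "bounded_dirichlet_solution n f \<longleftrightarrow>
     f \<in> extensional (lattice_closure (half_strip n)) \<and>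
     bounded (f ` lattice_closure (half_strip n)) \<and>
     (\<forall>z\<in>half_strip n. discrete_laplacian f z = 0) \<and>
     (\<forall>z\<in>left_side n. f z = 1) \<and>
     (\<forall>z\<in>lattice_boundary (half_strip n) - left_side n. f z = 0)"

end

theory Submission
  imports Defs
begin

text \<open>
  Adding a small multiple of the strictly superharmonic function \<open>x + y (n - y)\<close>, which tends to
  infinity along the half-strip, reduces the maximum principle for subharmonic functions that are
  bounded above to a maximum over a finite set. This gives uniqueness; existence follows by
  iterating the averaging operator, starting from zero, and passing to the monotone limit. For the
  estimate, the quadratic \<open>(x/n - 1)\<^sup>2 + 2 y/n - (y/n)\<^sup>2\<close> is discrete harmonic, nonnegative on
  the closed half-strip and at least \<open>1\<close> on its left side, so it dominates \<open>f\<close>;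
  at \<open>x = n\<close> its value is at most \<open>2 y/n\<close>.
\<close>

section \<open>The discrete Laplacian and the geometry of the half-strip\<close>

lemma discrete_laplacian_eq:
  "discrete_laplacian f (x, y) =
     (f (x + 1, y) + f (x - 1, y) + f (x, y + 1) + f (x, y - 1)) / 4 - f (x, y)"
  by (simp add: discrete_laplacian_def neighbours_eq field_simps)

lemma neighbours_subset_closure:
  assumes "z \<in> D"
  shows "neighbours z \<subseteq> lattice_closure D"
  using assms by (auto simp: lattice_closure_def lattice_boundary_def neighbours_def
      lattice_dist_def dist_commute)

text \<open>Neighbours of points of \<open>D\<close> stay in the closure. This allows a solution to
  be built as a total function and then restricted.\<close>

lemma discrete_laplacian_cong:
  assumes "z \<in> D" "\<And>w. w \<in> lattice_closure D \<Longrightarrow> f w = g w"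
  shows "discrete_laplacian f z = discrete_laplacian g z"
proof -
  have "f z = g z" using assms by (auto simp: lattice_closure_def)
  moreover have "f w = g w" if "w \<in> neighbours z" for w
    using assms neighbours_subset_closure that by blast
  ultimately show ?thesis by (simp add: discrete_laplacian_def)
qed

lemma closure_half_strip_bounds:
  assumes "(x, y) \<in> lattice_closure (half_strip n)"
  shows "0 \<le> x" "0 \<le> y" "y \<le> n"
proof -
  have "(x, y) \<in> half_strip n \<or> (\<exists>z\<in>half_strip n. (x, y) \<in> neighbours z)"
    using assms by (auto simp: lattice_closure_def lattice_boundary_def neighbours_def
        lattice_dist_def dist_commute)
  then show "0 \<le> x" "0 \<le> y" "y \<le> n"
    by (auto simp: half_strip_def neighbours_eq)
qed

text \<open>Restriction to the closure thus keeps the value 1 on the left side, and bounds proved on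
  the closure apply there.\<close>

lemma left_side_subset_boundary: "left_side n \<subseteq> lattice_boundary (half_strip n)"
proof
  fix z assume "z \<in> left_side n"
  then obtain y where z: "z = (0, y)" and y: "1 \<le> y" "y \<le> n - 1"
    by (auto simp: left_side_def)
  have "(1, y) \<in> neighbours (0, y)" by (simp add: neighbours_eq)
  moreover have "(1, y) \<in> half_strip n" using y by (simp add: half_strip_def)
  ultimately show "z \<in> lattice_boundary (half_strip n)"
    unfolding z lattice_boundary_def neighbours_def by (auto simp: half_strip_def)
qed

section \<open>Maximum principle, comparison and uniqueness\<close>

theorem half_strip_maximum_principle:
  fixes u :: "int \<times> int \<Rightarrow> real"
  assumes bdd: "bdd_above (u ` lattice_closure (half_strip n))"
    and sub: "\<And>z. z \<in> half_strip n \<Longrightarrow> 0 \<le> discrete_laplacian u z"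
    and bdry: "\<And>z. z \<in> lattice_boundary (half_strip n) \<Longrightarrow> u z \<le> 0"
    and z: "z \<in> lattice_closure (half_strip n)"
  shows "u z \<le> 0"
proof (rule ccontr)
  assume pos: "\<not> u z \<le> 0"
  let ?C = "lattice_closure (half_strip n)"
  define b where "b = (\<lambda>(x, y). real_of_int (x + y * (n - y)))"
  have b_ge: "real_of_int x \<le> b (x, y)" "0 \<le> b (x, y)" if "(x, y) \<in> ?C" for x y
  proof -
    have "0 \<le> y * (n - y)" "0 \<le> x" using closure_half_strip_bounds[OF that] by auto
    then show "real_of_int x \<le> b (x, y)" "0 \<le> b (x, y)"
      unfolding b_def prod.case of_int_le_iff of_int_0_le_iff by linarith+
  qed
  \<comment> \<open>The second difference of \<open>b\<close> is 0 in \<open>x\<close> and -2 in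
    \<open>y\<close>; the factor 1/4 gives -1/2.\<close>
  have lap_b: "discrete_laplacian b (x, y) = - 1 / 2" for x y
    by (simp add: discrete_laplacian_eq b_def field_simps)
  obtain M where M: "\<And>w. w \<in> ?C \<Longrightarrow> u w \<le> M"
    using bdd by (auto simp: bdd_above_def)
  \<comment> \<open>This size keeps \<open>e * b z\<close> at most half of \<open>u z\<close>, so
    \<open>v z\<close> stays positive; the summand 1 makes the denominator positive.\<close>
  define e where "e = u z / (2 * (1 + b z))"
  have bz: "0 \<le> b z" using b_ge(2) z by (cases z) auto
  then have e: "0 < e" using pos by (simp add: e_def)
  have "e * b z \<le> u z / 2"
    using pos bz by (simp add: e_def field_simps)
  define v where "v = (\<lambda>w. u w - e * b w)"
  have vz: "0 < v z" using \<open>e * b z \<le> u z / 2\<close> pos by (simp add: v_def)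
  \<comment> \<open>Where \<open>v\<close> is positive, \<open>e * x \<le> e * b (x, y) < M\<close>,
    so \<open>x\<close> cannot exceed \<open>N\<close>.\<close>
  define N where "N = \<lceil>M / e\<rceil>"
  define S where "S = {w \<in> half_strip n. fst w \<le> N}"
  have out: "w \<in> S" if "w \<in> ?C" "0 < v w" for w
  proof -
    obtain x y where w: "w = (x, y)" by (cases w)
    have "e * b w < M" using that M[of w] by (simp add: v_def)
    moreover have "e * x \<le> e * b w" using b_ge(1) that e w by simp
    ultimately have "e * x < M" by linarith
    then have "x < M / e" using e by (simp add: field_simps)
    then have "x \<le> N" unfolding N_def by linarith
    moreover have "w \<in> half_strip n"
    proof (rule ccontr)
      assume "w \<notin> half_strip n"
      then have "u w \<le> 0" using that bdry by (simp add: lattice_closure_def)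
      moreover have "0 \<le> e * b w" using b_ge(2) that(1) e w by simp
      ultimately show False using that(2) by (simp add: v_def)
    qed
    ultimately show ?thesis by (simp add: S_def w)
  qed
  have "S \<subseteq> {1..N} \<times> {1..n - 1}" by (auto simp: S_def half_strip_def)
  then have fin: "finite S" by (rule finite_subset) auto
  have "z \<in> S" using out z vz by blast
  define m where "m = Max (v ` S)"
  have "m \<in> v ` S" unfolding m_def using fin \<open>z \<in> S\<close> by (intro Max_in) auto
  then obtain x y where p: "(x, y) \<in> S" "v (x, y) = m" by auto
  have le_S: "v w \<le> m" if "w \<in> S" for w unfolding m_def using fin that by simp
  have "0 < m" using le_S[OF \<open>z \<in> S\<close>] vz by linarith
  \<comment> \<open>The maximum over \<open>S\<close> is one over the whole closure, since
    \<open>v\<close> is nonpositive off \<open>S\<close>.\<close>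
  then have le: "v w \<le> m" if "w \<in> ?C" for w
    using le_S out that by (cases "0 < v w") auto
  have p': "(x, y) \<in> half_strip n" using p by (simp add: S_def)
  have "v w \<le> m" if "w \<in> neighbours (x, y)" for w
    using neighbours_subset_closure[OF p'] that le by blast
  then have "discrete_laplacian v (x, y) \<le> 0"
    using p by (simp add: discrete_laplacian_def sum_nonpos)
  moreover have "discrete_laplacian v (x, y) =
      discrete_laplacian u (x, y) - e * discrete_laplacian b (x, y)"
    by (simp add: discrete_laplacian_eq v_def field_simps)
  \<comment> \<open>The Laplacian of \<open>v\<close> is at least \<open>e / 2\<close>, so it cannot
    be nonpositive at the maximum. Strictness spares any propagation of the maximum to the
    boundary.\<close>
  ultimately show False using lap_b[of x y] sub[OF p'] e by simp
qed

lemma bounded_dirichlet_solution_le: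
  fixes g :: "int \<times> int \<Rightarrow> real"
  assumes f: "bounded_dirichlet_solution n f"
    and bdd: "bdd_below (g ` lattice_closure (half_strip n))"
    and super: "\<And>z. z \<in> half_strip n \<Longrightarrow> discrete_laplacian g z \<le> 0"
    and left: "\<And>z. z \<in> left_side n \<Longrightarrow> 1 \<le> g z"
    and nonneg: "\<And>z. z \<in> lattice_boundary (half_strip n) - left_side n \<Longrightarrow> 0 \<le> g z"
    and z: "z \<in> lattice_closure (half_strip n)"
  shows "f z \<le> g z"
proof -
  have "f z - g z \<le> 0"
  proof (rule half_strip_maximum_principle[OF _ _ _ z])
    have "bdd_above (f ` lattice_closure (half_strip n))"
      using f by (simp add: bounded_dirichlet_solution_def bounded_imp_bdd_above)
    then obtain A where "\<And>w. w \<in> lattice_closure (half_strip n) \<Longrightarrow> f w \<le> A"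
      by (auto simp: bdd_above_def)
    moreover obtain B where "\<And>w. w \<in> lattice_closure (half_strip n) \<Longrightarrow> B \<le> g w"
      using bdd by (auto simp: bdd_below_def)
    ultimately show "bdd_above ((\<lambda>w. f w - g w) ` lattice_closure (half_strip n))"
      by (intro bdd_aboveI2[where M = "A - B"] diff_mono)
    show "0 \<le> discrete_laplacian (\<lambda>w. f w - g w) w" if "w \<in> half_strip n" for w
    proof -
      have "discrete_laplacian (\<lambda>w. f w - g w) w = discrete_laplacian f w - discrete_laplacian g w"
        by (cases w) (simp add: discrete_laplacian_eq field_simps)
      then show ?thesis using f super[OF that] that by (simp add: bounded_dirichlet_solution_def)
    qed
    show "f w - g w \<le> 0" if "w \<in> lattice_boundary (half_strip n)" for w
      using f left[of w] nonneg[of w] that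
      by (cases "w \<in> left_side n") (auto simp: bounded_dirichlet_solution_def)
  qed
  then show ?thesis by simp
qed

text \<open>Each solution is a barrier for the other; extensionality turns agreement on the closure
  into equality.\<close>

lemma bounded_dirichlet_solution_unique:
  assumes f: "bounded_dirichlet_solution n f" and g: "bounded_dirichlet_solution n g"
  shows "f = g"
proof (rule extensionalityI)
  show "f \<in> extensional (lattice_closure (half_strip n))"
    "g \<in> extensional (lattice_closure (half_strip n))"
    using f g by (simp_all add: bounded_dirichlet_solution_def)
  have le: "f' z \<le> g' z"
    if "bounded_dirichlet_solution n f'" "bounded_dirichlet_solution n g'"
      "z \<in> lattice_closure (half_strip n)" for f' g' z
    using that(2)
    by (intro bounded_dirichlet_solution_le[OF that(1) _ _ _ _ that(3)])
      (auto simp: bounded_dirichlet_solution_def bounded_imp_bdd_below)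
  show "f z = g z" if "z \<in> lattice_closure (half_strip n)" for z
    using le[OF f g that] le[OF g f that] by simp
qed

section \<open>Existence by monotone iteration\<close>

text \<open>The boundary data are built in, so that fixed points are harmonic in the half-strip with
  the prescribed boundary values.\<close>

definition averaging :: "int \<Rightarrow> (int \<times> int \<Rightarrow> real) \<Rightarrow> int \<times> int \<Rightarrow> real" where
  "averaging n g = (\<lambda>(x, y).
     if (x, y) \<in> half_strip n then (g (x + 1, y) + g (x - 1, y) + g (x, y + 1) + g (x, y - 1)) / 4
     else if (x, y) \<in> left_side n then 1 else 0)"

lemma averaging_mono: "(\<And>w. g w \<le> h w) \<Longrightarrow> averaging n g z \<le> averaging n h z"
  by (cases z) (auto simp: averaging_def intro!: divide_right_mono add_mono)

text \<open>Averaging sends the constant 0 above itself and the constant 1 below itself;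
  monotonicity does the rest.\<close>

lemma averaging_iterate_bounds:
  "0 \<le> (averaging n ^^ k) (\<lambda>_. 0) z \<and> (averaging n ^^ k) (\<lambda>_. 0) z \<le> 1"
proof (induction k arbitrary: z)
  case (Suc k)
  have "averaging n (\<lambda>_. 0) z \<le> (averaging n ^^ Suc k) (\<lambda>_. 0) z"
    "(averaging n ^^ Suc k) (\<lambda>_. 0) z \<le> averaging n (\<lambda>_. 1) z"
    using Suc by (auto intro: averaging_mono)
  moreover have "0 \<le> averaging n (\<lambda>_. 0) z" "averaging n (\<lambda>_. 1) z \<le> 1"
    by (auto simp: averaging_def split: prod.split)
  ultimately show ?case by linarith
qed simp

lemma averaging_iterate_le_Suc:
  "(averaging n ^^ k) (\<lambda>_. 0) z \<le> (averaging n ^^ Suc k) (\<lambda>_. 0) z"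
proof (induction k arbitrary: z)
  case 0
  then show ?case using averaging_iterate_bounds[of "Suc 0" n z] by simp
next
  case (Suc k)
  then show ?case using averaging_mono[of "(averaging n ^^ k) (\<lambda>_. 0)"] by simp
qed

lemma averaging_fixpoint_exists:
  obtains F where "averaging n F = F" "\<And>z. 0 \<le> F z" "\<And>z. F z \<le> 1"
proof -
  define I where "I = (\<lambda>k. (averaging n ^^ k) (\<lambda>_. 0))"
  have "convergent (\<lambda>k. I k z)" for z
  proof (rule Bseq_monoseq_convergent)
    show "Bseq (\<lambda>k. I k z)"
      using averaging_iterate_bounds by (intro BseqI'[where K = 1]) (simp add: I_def)
    show "monoseq (\<lambda>k. I k z)"
      using averaging_iterate_le_Suc by (intro incseq_imp_monoseq incseq_SucI) (simp add: I_def)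
  qed
  then obtain F where lim: "\<And>z. (\<lambda>k. I k z) \<longlonglongrightarrow> F z"
    unfolding convergent_def by metis
  have "averaging n F z = F z" for z
  proof -
    \<comment> \<open>Averaging reads at most four values, so it commutes with pointwise
      limits.\<close>
    have "(\<lambda>k. averaging n (I k) z) \<longlonglongrightarrow> averaging n F z"
      by (cases z) (auto simp: averaging_def intro!: tendsto_intros lim)
    moreover have "(\<lambda>k. averaging n (I k) z) = (\<lambda>k. I (Suc k) z)"
      by (simp add: I_def)
    ultimately show ?thesis using LIMSEQ_Suc[OF lim[of z]] LIMSEQ_unique by simp
  qed
  moreover have "0 \<le> F z" "F z \<le> 1" for z
    using averaging_iterate_bounds[of _ n z]
    by (auto intro!: LIMSEQ_le_const[OF lim] LIMSEQ_le_const2[OF lim] simp: I_def)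
  ultimately show ?thesis using that by blast
qed

lemma bounded_dirichlet_solution_exists: "\<exists>f. bounded_dirichlet_solution n f"
proof -
  let ?C = "lattice_closure (half_strip n)"
  obtain F where F: "averaging n F = F" "\<And>z. 0 \<le> F z" "\<And>z. F z \<le> 1"
    using averaging_fixpoint_exists by blast
  have F_eq: "F z = averaging n F z" for z using F(1) by simp
  have "discrete_laplacian (restrict F ?C) z = 0" if "z \<in> half_strip n" for z
  proof -
    have "discrete_laplacian F z = 0"
      using that F_eq[of z] by (cases z) (simp add: discrete_laplacian_eq averaging_def)
    then show ?thesis using discrete_laplacian_cong[OF that, of "restrict F ?C" F] by simp
  qed
  moreover have "F z = 1" if "z \<in> left_side n" for z
    using that F_eq[of z] by (auto simp: averaging_def left_side_def half_strip_def)
  moreover have "F z = 0" if "z \<in> lattice_boundary (half_strip n) - left_side n" for z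
    using that F_eq[of z] by (cases z) (simp add: averaging_def lattice_boundary_def)
  moreover have "bounded (F ` ?C)"
    using F(2,3) by (intro boundedI[where B = 1]) (auto simp: abs_le_iff order_trans[of _ 0])
  ultimately have "bounded_dirichlet_solution n (restrict F ?C)"
    using left_side_subset_boundary[of n]
    by (auto simp: bounded_dirichlet_solution_def lattice_closure_def)
  then show ?thesis by blast
qed

section \<open>The linear bound by a quadratic barrier\<close>

lemma bounded_dirichlet_solution_estimate:
  assumes f: "bounded_dirichlet_solution n f" and y: "1 \<le> y" "y \<le> n - 1"
  shows "f (n, y) \<le> 2 * (real_of_int y / real_of_int n)"
proof -
  have n: "0 < real_of_int n" using y by simp
  define q where "q = (\<lambda>(x, y). (real_of_int x / n - 1)\<^sup>2 +
      (2 * (real_of_int y / n) - (real_of_int y / n)\<^sup>2))"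
  have q_ge: "(real_of_int x / n - 1)\<^sup>2 \<le> q (x, y)"
    if "(x, y) \<in> lattice_closure (half_strip n)" for x y
  proof -
    define t where "t = real_of_int y / n"
    have "0 \<le> t" "t \<le> 1" using closure_half_strip_bounds[OF that] n by (auto simp: t_def)
    then have "0 \<le> t * (2 - t)" by simp
    moreover have "q (x, y) = (real_of_int x / n - 1)\<^sup>2 + t * (2 - t)"
      by (simp add: q_def t_def power2_eq_square right_diff_distrib)
    ultimately show ?thesis by simp
  qed
  have q_nonneg: "0 \<le> q z" if "z \<in> lattice_closure (half_strip n)" for z
    using that q_ge zero_le_power2 order_trans by (cases z) blast
  have "f (n, y) \<le> q (n, y)"
  proof (rule bounded_dirichlet_solution_le[OF f])
    show "bdd_below (q ` lattice_closure (half_strip n))"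
      using q_nonneg by (intro bdd_belowI2[where m = 0])
    \<comment> \<open>The second differences in \<open>x\<close> and \<open>y\<close> are
      \<open>2 / n^2\<close> and \<open>- 2 / n^2\<close>, so they cancel.\<close>
    show "discrete_laplacian q z \<le> 0" for z
      using n by (cases z) (simp add: discrete_laplacian_eq q_def field_simps power2_eq_square)
    show "1 \<le> q z" if "z \<in> left_side n" for z
    proof -
      have "z \<in> lattice_closure (half_strip n)"
        using that left_side_subset_boundary by (auto simp: lattice_closure_def)
      then show ?thesis using that q_ge[of 0 "snd z"] by (auto simp: left_side_def)
    qed
    show "0 \<le> q z" if "z \<in> lattice_boundary (half_strip n) - left_side n" for z
      using that q_nonneg by (simp add: lattice_closure_def)
    show "(n, y) \<in> lattice_closure (half_strip n)"
      using y by (simp add: lattice_closure_def half_strip_def)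
  qed
  \<comment> \<open>At \<open>x = n\<close> the first square vanishes, and the term
    \<open>- (y / n)^2\<close> is dropped.\<close>
  also have "\<dots> \<le> 2 * (real_of_int y / n)"
    using n by (simp add: q_def)
  finally show ?thesis .
qed

theorem lemma6p5:
  shows "\<exists>K::real. K > 0 \<and>
    (\<forall>n::int. n \<ge> 2 \<longrightarrow>
      (\<exists>!f. bounded_dirichlet_solution n f) \<and>
      (\<forall>f. bounded_dirichlet_solution n f \<longrightarrow>
        (\<forall>y\<in>{1..n - 1}. f (n, y) \<le> K * (real_of_int y / real_of_int n))))"
  using bounded_dirichlet_solution_exists bounded_dirichlet_solution_unique
    bounded_dirichlet_solution_estimate
  by (intro exI[of _ 2]) fastforce

end
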